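(* Consider the nonlinear system $\dot x(t)=f(x(t),w(t))$, $z(t)=h(x(t),w(t))$, and let the LPV representation $$\dot x_{\mathrm v}(t)=A(p(t))x_{\mathrm v}(t)+B(p(t))w_{\mathrm v}(t),\qquad z_{\mathrm v}(t)=C(p(t))x_{\mathrm v}(t)+D(p(t))w_{\mathrm v}(t)$$ with scheduling-variable $p(t)\in\mathcal P$ be a velocity parameter-varying (VPV) embedding of the system on the region $\mathsf{X}\times\mathsf{W}$ with $\mathsf{X}\times\mathsf{W}=\mathcal X\times\mathcal W$. If the LPV representation is classically dissipative (with respect to a supply function $s_{\mathrm v}$), then the nonlinear system is velocity dissipative (with respect to $s_{\mathrm v}$).
   Context: Here $\mathsf{X},\mathsf{W}$ simply denote sets (sans-serif letters for the embedding region). System: $\dot x=f(x,w)$, $z=h(x,w)$ on $t\in[0,\infty)$, with $x(t)\in\mathcal X\subseteq\mathbb R^{n_x}$, $w(t)\in\mathcal W\subseteq\mathbb R^{n_w}$, $z(t)\in\mathcal Z\subseteq\mathbb R^{n_z}$, $f:\mathcal X\times\mathcal W\to\mathbb R^{n_x}$, $h:\mathcal X\times\mathcal W\to\mathcal Z$ in $\mathcal C_1$ ($\mathcal C_n$ = $n$-times continuously differentiable). $\mathfrak B^{\mathrm C}$ is the set of solutions $(x,w,z):[0,\infty)\to\mathcal X\times\mathcal W\times\mathcal Z$ with $x\in\mathcal C_2$, $w,z\in\mathcal C_1$ (differentiability also at $t=0$); solutions are assumed forward complete and unique. $\mathfrak B^{\mathrm{VF}}=\{(\dot x,\dot w,\dot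 z):(x,w,z)\in\mathfrak B^{\mathrm C}\}$ is the solution set of the velocity form $\ddot x=A_{\mathrm v}(x,w)\dot x+B_{\mathrm v}(x,w)\dot w$, $\dot z=C_{\mathrm v}(x,w)\dot x+D_{\mathrm v}(x,w)\dot w$, with $A_{\mathrm v}=\partial f/\partial x$, $B_{\mathrm v}=\partial f/\partial w$, $C_{\mathrm v}=\partial h/\partial x$, $D_{\mathrm v}=\partial h/\partial w$. VPV embedding on $\mathsf{X}\times\mathsf{W}\subseteq\mathcal X\times\mathcal W$: the matrix functions $A,\dots,D$ on $\mathcal P\subset\mathbb R^{n_p}$ (belonging to a given function class, e.g. affine or rational) are such that there is a scheduling map $\eta:\mathsf{X}\times\mathsf{W}\to\mathcal P$, $p=\eta(x,w)$, $\mathcal P\supseteq\eta(\mathsf{X},\mathsf{W})$, with $A(\eta(x,w))=A_{\mathrm v}(x,w)$, $B(\eta(x,w))=B_{\mathrm v}(x,w)$, $C(\eta(x,w))=C_{\mathrm v}(x,w)$, $D(\eta(x,w))=D_{\mathrm v}(x,w)$ for all $(x,w)\in\mathsf{X}\times\mathsf{W}$. $\mathfrak B^{\mathrm{VPV}}$: the union over all $p:[0,\infty)\to\mathcal P$ of the sets of $(x_{\mathrm v},w_{\mathrm v},z_{\mathrm v}):[0,\infty)\to\mathbb R^{n_x}\times\mathbb R^{n_w}\times\mathbb R^{n_z}$ with $x_{\mathrm v}\in\mathcal C_1$, $w_{\mathrm v},z_{\mathrm v}\in\mathcal C_0$ satisfying the LPV equations for $p$. Classical dissipativity of the LPV representation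 with respect to $s_{\mathrm v}:\mathbb R^{n_w}\times\mathbb R^{n_z}\to\mathbb R$: there is a storage function $\mathcal V_{\mathrm v}:\mathbb R^{n_x}\to[0,\infty)$, $\mathcal V_{\mathrm v}\in\mathcal C_1$, positive definite and decrescent with respect to $0$ (i.e., $a(\|\xi\|)\le\mathcal V_{\mathrm v}(\xi)\le b(\|\xi\|)$ for some continuous strictly increasing $a,b:[0,\infty)\to[0,\infty)$ vanishing at $0$), with $\mathcal V_{\mathrm v}(x_{\mathrm v}(t_1))-\mathcal V_{\mathrm v}(x_{\mathrm v}(t_0))\le\int_{t_0}^{t_1}s_{\mathrm v}(w_{\mathrm v}(t),z_{\mathrm v}(t))dt$ for all $0\le t_0\le t_1$ and all $(x_{\mathrm v},w_{\mathrm v},z_{\mathrm v})\in\mathfrak B^{\mathrm{VPV}}$. Velocity dissipativity of the nonlinear system with respect to $s_{\mathrm v}$: the same inequality holds, for some storage function with these properties, for all $(\dot x,\dot w,\dot z)\in\mathfrak B^{\mathrm{VF}}$ in place of $(x_{\mathrm v},w_{\mathrm v},z_{\mathrm v})$. *)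

theory Defs
  imports "HOL-Analysis.Analysis"
begin

text \<open>
  Continuous differentiability on a set that need not be open: a derivative relative to the set
  exists at every point and can be chosen continuously. On open sets this is the usual
  notion; functions with a \<open>C\<^sub>1\<close> extension to an open superset satisfy it as well.
\<close>

definition C1_on :: "'a::real_normed_vector set \<Rightarrow> ('a \<Rightarrow> 'b::real_normed_vector) \<Rightarrow> bool" where
  "C1_on S g \<longleftrightarrow>
    (\<exists>g'. (\<forall>s\<in>S. (g has_derivative blinfun_apply (g' s)) (at s within S)) \<and> continuous_on S g')"

text \<open>
  \<open>C\<^sub>n\<close> curves on a time interval, with one-sided derivatives at end points contained in it.
  (The library's \<open>C1_differentiable_on\<close> asks for two-sided derivatives.)
\<close>

primrec Cn_curve :: "nat \<Rightarrow> real set \<Rightarrow> (real \<Rightarrow> 'a::real_normed_vector) \<Rightarrow> bool" where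
  "Cn_curve 0 I x \<longleftrightarrow> continuous_on I x"
| "Cn_curve (Suc n) I x \<longleftrightarrow>
    x differentiable_on I \<and> Cn_curve n I (\<lambda>t. vector_derivative x (at t within I))"

text \<open>Trajectories are total functions on \<open>real\<close>; only their values on the time interval matter.\<close>

definition solutions ::
  "(real^'nx) set \<Rightarrow> (real^'nw) set \<Rightarrow> (real^'nz) set \<Rightarrow>
   ((real^'nx) \<times> (real^'nw) \<Rightarrow> real^'nx) \<Rightarrow> ((real^'nx) \<times> (real^'nw) \<Rightarrow> real^'nz) \<Rightarrow> real set \<Rightarrow>
   ((real \<Rightarrow> real^'nx) \<times> (real \<Rightarrow> real^'nw) \<times> (real \<Rightarrow> real^'nz)) set" where
  "solutions X W Z f h I =
    {(x, w, z). Cn_curve 2 I x \<and> Cn_curve 1 I w \<and> Cn_curve 1 I z \<and>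
       (\<forall>t\<in>I. x t \<in> X \<and> w t \<in> W \<and> z t \<in> Z \<and>
          (x has_vector_derivative f (x t, w t)) (at t within I) \<and> z t = h (x t, w t))}"

abbreviation behaviour where
  "behaviour X W Z f h \<equiv> solutions X W Z f h {0..}"

text \<open>Every solution on some \<open>[0, T)\<close> under a globally defined input extends to \<open>[0, \<infinity>)\<close>.\<close>

definition forward_complete ::
  "(real^'nx) set \<Rightarrow> (real^'nw) set \<Rightarrow> (real^'nz) set \<Rightarrow>
   ((real^'nx) \<times> (real^'nw) \<Rightarrow> real^'nx) \<Rightarrow> ((real^'nx) \<times> (real^'nw) \<Rightarrow> real^'nz) \<Rightarrow> bool" where
  "forward_complete X W Z f h \<longleftrightarrow>
    (\<forall>T x w z. T > 0 \<longrightarrow> (x, w, z) \<in> solutions X W Z f h {0..<T} \<longrightarrow>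
       Cn_curve 1 {0..} w \<longrightarrow> (\<forall>t\<ge>0. w t \<in> W) \<longrightarrow>
       (\<exists>x' z'. (x', w, z') \<in> behaviour X W Z f h \<and> (\<forall>t\<in>{0..<T}. x' t = x t)))"

definition unique_solutions ::
  "(real^'nx) set \<Rightarrow> (real^'nw) set \<Rightarrow> (real^'nz) set \<Rightarrow>
   ((real^'nx) \<times> (real^'nw) \<Rightarrow> real^'nx) \<Rightarrow> ((real^'nx) \<times> (real^'nw) \<Rightarrow> real^'nz) \<Rightarrow> bool" where
  "unique_solutions X W Z f h \<longleftrightarrow>
    (\<forall>x w z x' w' z'. (x, w, z) \<in> behaviour X W Z f h \<longrightarrow> (x', w', z') \<in> behaviour X W Z f h \<longrightarrow>
       x 0 = x' 0 \<longrightarrow> (\<forall>t\<ge>0. w t = w' t) \<longrightarrow> (\<forall>t\<ge>0. x t = x' t \<and> z t = z' t))"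

definition nonlinear_system ::
  "(real^'nx) set \<Rightarrow> (real^'nw) set \<Rightarrow> (real^'nz) set \<Rightarrow>
   ((real^'nx) \<times> (real^'nw) \<Rightarrow> real^'nx) \<Rightarrow> ((real^'nx) \<times> (real^'nw) \<Rightarrow> real^'nz) \<Rightarrow> bool" where
  "nonlinear_system X W Z f h \<longleftrightarrow>
    C1_on (X \<times> W) f \<and> C1_on (X \<times> W) h \<and> h \<in> X \<times> W \<rightarrow> Z \<and>
    forward_complete X W Z f h \<and> unique_solutions X W Z f h"

text \<open>
  \<open>Gx = \<partial>g/\<partial>x\<close> and \<open>Gw = \<partial>g/\<partial>w\<close> on \<open>X \<times> W\<close>. A relation rather than a function because
  derivatives relative to \<open>X\<close> or \<open>W\<close> need not be unique when these sets are thin;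
  for open sets the matrices are determined.
\<close>

definition partial_jacobians ::
  "(real^'nx) set \<Rightarrow> (real^'nw) set \<Rightarrow> ((real^'nx) \<times> (real^'nw) \<Rightarrow> real^'m) \<Rightarrow>
   ((real^'nx) \<times> (real^'nw) \<Rightarrow> real^'nx^'m) \<Rightarrow> ((real^'nx) \<times> (real^'nw) \<Rightarrow> real^'nw^'m) \<Rightarrow> bool" where
  "partial_jacobians X W g Gx Gw \<longleftrightarrow>
    (\<forall>x\<in>X. \<forall>w\<in>W.
       ((\<lambda>\<xi>. g (\<xi>, w)) has_derivative (*v) (Gx (x, w))) (at x within X) \<and>
       ((\<lambda>\<omega>. g (x, \<omega>)) has_derivative (*v) (Gw (x, w))) (at w within W))"

definition velocity_behaviour ::
  "(real^'nx) set \<Rightarrow> (real^'nw) set \<Rightarrow> (real^'nz) set \<Rightarrow>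
   ((real^'nx) \<times> (real^'nw) \<Rightarrow> real^'nx) \<Rightarrow> ((real^'nx) \<times> (real^'nw) \<Rightarrow> real^'nz) \<Rightarrow>
   ((real \<Rightarrow> real^'nx) \<times> (real \<Rightarrow> real^'nw) \<times> (real \<Rightarrow> real^'nz)) set" where
  "velocity_behaviour X W Z f h =
    {(\<lambda>t. vector_derivative x (at t within {0..}),
      \<lambda>t. vector_derivative w (at t within {0..}),
      \<lambda>t. vector_derivative z (at t within {0..})) | x w z. (x, w, z) \<in> behaviour X W Z f h}"

text \<open>The matrix function \<open>M\<close> coincides on \<open>P\<close> entrywise with members of the class \<open>F\<close>.\<close>

definition matrix_fun_in_class ::
  "((real^'np) \<Rightarrow> real) set \<Rightarrow> (real^'np) set \<Rightarrow> (real^'np \<Rightarrow> real^'n^'m) \<Rightarrow> bool" where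
  "matrix_fun_in_class F P M \<longleftrightarrow> (\<forall>i j. \<exists>g\<in>F. \<forall>p\<in>P. M p $ i $ j = g p)"

definition vpv_embedding ::
  "((real^'np) \<Rightarrow> real) set \<Rightarrow> (real^'nx) set \<Rightarrow> (real^'nw) set \<Rightarrow>
   ((real^'nx) \<times> (real^'nw) \<Rightarrow> real^'nx^'nx) \<Rightarrow> ((real^'nx) \<times> (real^'nw) \<Rightarrow> real^'nw^'nx) \<Rightarrow>
   ((real^'nx) \<times> (real^'nw) \<Rightarrow> real^'nx^'nz) \<Rightarrow> ((real^'nx) \<times> (real^'nw) \<Rightarrow> real^'nw^'nz) \<Rightarrow>
   (real^'nx) set \<Rightarrow> (real^'nw) set \<Rightarrow> (real^'np) set \<Rightarrow>
   (real^'np \<Rightarrow> real^'nx^'nx) \<Rightarrow> (real^'np \<Rightarrow> real^'nw^'nx) \<Rightarrow>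
   (real^'np \<Rightarrow> real^'nx^'nz) \<Rightarrow> (real^'np \<Rightarrow> real^'nw^'nz) \<Rightarrow> bool" where
  "vpv_embedding F X W Av Bv Cv Dv XX WW P A B C D \<longleftrightarrow>
    XX \<times> WW \<subseteq> X \<times> W \<and>
    matrix_fun_in_class F P A \<and> matrix_fun_in_class F P B \<and>
    matrix_fun_in_class F P C \<and> matrix_fun_in_class F P D \<and>
    (\<exists>\<eta>. \<eta> \<in> XX \<times> WW \<rightarrow> P \<and>
       (\<forall>x\<in>XX. \<forall>w\<in>WW.
          A (\<eta> (x, w)) = Av (x, w) \<and> B (\<eta> (x, w)) = Bv (x, w) \<and>
          C (\<eta> (x, w)) = Cv (x, w) \<and> D (\<eta> (x, w)) = Dv (x, w)))"

definition lpv_behaviour ::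
  "(real^'np \<Rightarrow> real^'nx^'nx) \<Rightarrow> (real^'np \<Rightarrow> real^'nw^'nx) \<Rightarrow>
   (real^'np \<Rightarrow> real^'nx^'nz) \<Rightarrow> (real^'np \<Rightarrow> real^'nw^'nz) \<Rightarrow> (real \<Rightarrow> real^'np) \<Rightarrow>
   ((real \<Rightarrow> real^'nx) \<times> (real \<Rightarrow> real^'nw) \<times> (real \<Rightarrow> real^'nz)) set" where
  "lpv_behaviour A B C D p =
    {(x, w, z). Cn_curve 1 {0..} x \<and> Cn_curve 0 {0..} w \<and> Cn_curve 0 {0..} z \<and>
       (\<forall>t\<ge>0. (x has_vector_derivative (A (p t) *v x t + B (p t) *v w t)) (at t within {0..}) \<and>
              z t = C (p t) *v x t + D (p t) *v w t)}"

definition vpv_behaviour ::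
  "(real^'np) set \<Rightarrow> (real^'np \<Rightarrow> real^'nx^'nx) \<Rightarrow> (real^'np \<Rightarrow> real^'nw^'nx) \<Rightarrow>
   (real^'np \<Rightarrow> real^'nx^'nz) \<Rightarrow> (real^'np \<Rightarrow> real^'nw^'nz) \<Rightarrow>
   ((real \<Rightarrow> real^'nx) \<times> (real \<Rightarrow> real^'nw) \<times> (real \<Rightarrow> real^'nz)) set" where
  "vpv_behaviour P A B C D = (\<Union>p\<in>{0..} \<rightarrow> P. lpv_behaviour A B C D p)"

definition class_K :: "(real \<Rightarrow> real) \<Rightarrow> bool" where
  "class_K a \<longleftrightarrow>
    a \<in> {0..} \<rightarrow> {0..} \<and> continuous_on {0..} a \<and> strict_mono_on {0..} a \<and> a 0 = 0"

definition storage_function :: "(real^'nx \<Rightarrow> real) \<Rightarrow> bool" where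
  "storage_function V \<longleftrightarrow>
    (\<forall>\<xi>. V \<xi> \<ge> 0) \<and> C1_on UNIV V \<and>
    (\<exists>a b. class_K a \<and> class_K b \<and> (\<forall>\<xi>. a (norm \<xi>) \<le> V \<xi> \<and> V \<xi> \<le> b (norm \<xi>)))"

text \<open>
  The supply function carries no regularity assumption, so existence of the integral is part of
  the dissipation inequality (\<open>integral\<close> is 0 on non-integrable functions).
\<close>

definition dissipative_behaviour ::
  "(real^'nw \<Rightarrow> real^'nz \<Rightarrow> real) \<Rightarrow>
   ((real \<Rightarrow> real^'nx) \<times> (real \<Rightarrow> real^'nw) \<times> (real \<Rightarrow> real^'nz)) set \<Rightarrow> bool" where
  "dissipative_behaviour s \<BB> \<longleftrightarrow>
    (\<exists>V. storage_function V \<and>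
       (\<forall>(x, w, z)\<in>\<BB>. \<forall>t0 t1. 0 \<le> t0 \<longrightarrow> t0 \<le> t1 \<longrightarrow>
          (\<lambda>t. s (w t) (z t)) integrable_on {t0..t1} \<and>
          V (x t1) - V (x t0) \<le> integral {t0..t1} (\<lambda>t. s (w t) (z t))))"

definition classically_dissipative where
  "classically_dissipative P A B C D s \<longleftrightarrow> dissipative_behaviour s (vpv_behaviour P A B C D)"

definition velocity_dissipative where
  "velocity_dissipative X W Z f h s \<longleftrightarrow> dissipative_behaviour s (velocity_behaviour X W Z f h)"

end

theory Submission
  imports Defs
begin

text \<open>
  Along a solution, the time derivative of \<open>f(x, w)\<close> is given by the Jacobians, so
  \<open>(x', w', z')\<close> solves the LPV equations for \<open>p = \<eta>(x, w)\<close>. Thus the velocity behaviour is contained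
  in the VPV behaviour, and any storage function for the latter serves for the former.
\<close>

text \<open>Derivatives within \<open>{a..}\<close> are unique because the points to the right of
  \<open>t\<close> alone accumulate at \<open>t\<close>. This covers the end point \<open>a\<close>,
  where only a one-sided derivative exists.\<close>

lemma vector_derivative_within_Ici:
  fixes x :: "real \<Rightarrow> 'a::real_normed_vector"
  assumes "(x has_vector_derivative v) (at t within {a..})" and "t \<ge> a"
  shows "vector_derivative x (at t within {a..}) = v"
proof -
  have "at t within {a..} \<noteq> bot"
  proof -
    have "t islimpt {t..t+1}"
      by (simp add: islimpt_Icc)
    then have "t islimpt {a..}"
      by (rule islimpt_subset) (use \<open>t \<ge> a\<close> in auto)
    then show ?thesis
      by (simp add: trivial_limit_within)
  qed
  then show ?thesis
    using assms(1) by (rule vector_derivative_within)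
qed

text \<open>
  On thin sets the total derivative of \<open>g\<close> and its partial Jacobians need not be determined, but
  in the direction of the velocity of a curve in the set they agree, since both give the
  derivative of \<open>g\<close> along the curve with the other argument frozen.
\<close>

lemma partial_jacobians_chain_rule:
  assumes C1: "C1_on (X \<times> W) g" and jac: "partial_jacobians X W g Gx Gw"
    and x: "(x has_vector_derivative x') (at t within {a..})" "x ` {a..} \<subseteq> X"
    and w: "(w has_vector_derivative w') (at t within {a..})" "w ` {a..} \<subseteq> W"
    and t: "t \<ge> a"
  shows "((\<lambda>t. g (x t, w t)) has_vector_derivative (Gx (x t, w t) *v x' + Gw (x t, w t) *v w'))
    (at t within {a..})"
proof -
  let ?I = "{a..}"
  have mem: "x t \<in> X" "w t \<in> W"
    using x(2) w(2) t by auto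
  obtain g' where g': "(g has_derivative blinfun_apply g') (at (x t, w t) within X \<times> W)"
    using C1 mem unfolding C1_on_def by blast
  \<comment> \<open>One fixed total derivative \<open>g'\<close> serves every curve in
    \<open>X \<times> W\<close> that passes through \<open>(x t, w t)\<close> at time
    \<open>t\<close>. It is applied to three of them: \<open>w\<close> frozen, \<open>x\<close>
    frozen, and the given curve.\<close>
  have along: "((\<lambda>\<tau>. g (u \<tau>, v \<tau>)) has_vector_derivative blinfun_apply g' (u', v')) (at t within ?I)"
    if "(u has_vector_derivative u') (at t within ?I)" "u ` ?I \<subseteq> X" "u t = x t"
      "(v has_vector_derivative v') (at t within ?I)" "v ` ?I \<subseteq> W" "v t = w t" for u v u' v'
  proof -
    have "((\<lambda>\<tau>. (u \<tau>, v \<tau>)) has_vector_derivative (u', v')) (at t within ?I)"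
      using that(1,4) by (rule has_vector_derivative_Pair)
    moreover have "(g has_derivative blinfun_apply g')
        (at (u t, v t) within (\<lambda>\<tau>. (u \<tau>, v \<tau>)) ` ?I)"
      unfolding that(3,6) using g' by (rule has_derivative_subset) (use that in auto)
    ultimately show ?thesis
      using vector_derivative_diff_chain_within unfolding comp_def by fastforce
  qed
  \<comment> \<open>With \<open>w\<close> frozen, the derivative is computed once from the partial
    Jacobian and once from \<open>g'\<close>; uniqueness of the derivative in time equates the two
    values.\<close>
  have "((\<lambda>\<tau>. g (x \<tau>, w t)) has_vector_derivative Gx (x t, w t) *v x') (at t within ?I)"
    using vector_derivative_diff_chain_within[OF x(1), of "\<lambda>\<xi>. g (\<xi>, w t)" "(*v) (Gx (x t, w t))"]
      has_derivative_subset[OF _ x(2)] jac mem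
    unfolding partial_jacobians_def comp_def by blast
  moreover have "((\<lambda>\<tau>. g (x \<tau>, w t)) has_vector_derivative blinfun_apply g' (x', 0)) (at t within ?I)"
    by (rule along) (use x mem in auto)
  ultimately have gx: "blinfun_apply g' (x', 0) = Gx (x t, w t) *v x'"
    using vector_derivative_within_Ici t by metis
  have "((\<lambda>\<tau>. g (x t, w \<tau>)) has_vector_derivative Gw (x t, w t) *v w') (at t within ?I)"
    using vector_derivative_diff_chain_within[OF w(1), of "\<lambda>\<omega>. g (x t, \<omega>)" "(*v) (Gw (x t, w t))"]
      has_derivative_subset[OF _ w(2)] jac mem
    unfolding partial_jacobians_def comp_def by blast
  moreover have "((\<lambda>\<tau>. g (x t, w \<tau>)) has_vector_derivative blinfun_apply g' (0, w')) (at t within ?I)"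
    by (rule along) (use w mem in auto)
  ultimately have gw: "blinfun_apply g' (0, w') = Gw (x t, w t) *v w'"
    using vector_derivative_within_Ici t by metis
  \<comment> \<open>Linearity of \<open>g'\<close> on the splitting
    \<open>(x', w') = (x', 0) + (0, w')\<close>.\<close>
  have "blinfun_apply g' (x', w') = Gx (x t, w t) *v x' + Gw (x t, w t) *v w'"
    using blinfun.add_right[of g' "(x', 0)" "(0, w')"] by (simp add: gx gw)
  then show ?thesis
    using along[OF x refl w refl] by simp
qed

lemma velocity_behaviour_subset_vpv_behaviour:
  assumes f: "C1_on (X \<times> W) f" "partial_jacobians X W f Av Bv"
    and h: "C1_on (X \<times> W) h" "partial_jacobians X W h Cv Dv"
    and emb: "vpv_embedding F X W Av Bv Cv Dv XX WW P A B C D" "XX \<times> WW = X \<times> W"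
  shows "velocity_behaviour X W Z f h \<subseteq> vpv_behaviour P A B C D"
proof
  fix traj
  assume "traj \<in> velocity_behaviour X W Z f h"
  then obtain x w z where sol: "(x, w, z) \<in> behaviour X W Z f h"
    and traj: "traj = (\<lambda>t. vector_derivative x (at t within {0..}),
      \<lambda>t. vector_derivative w (at t within {0..}), \<lambda>t. vector_derivative z (at t within {0..}))"
    unfolding velocity_behaviour_def by blast
  define x' w' z' where "x' = (\<lambda>t. vector_derivative x (at t within {0..}))"
    and "w' = (\<lambda>t. vector_derivative w (at t within {0..}))"
    and "z' = (\<lambda>t. vector_derivative z (at t within {0..}))"
  obtain \<eta> where \<eta>: "\<eta> \<in> X \<times> W \<rightarrow> P"
    "\<And>\<xi> \<omega>. \<xi> \<in> X \<Longrightarrow> \<omega> \<in> W \<Longrightarrow>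
      A (\<eta> (\<xi>, \<omega>)) = Av (\<xi>, \<omega>) \<and> B (\<eta> (\<xi>, \<omega>)) = Bv (\<xi>, \<omega>) \<and>
      C (\<eta> (\<xi>, \<omega>)) = Cv (\<xi>, \<omega>) \<and> D (\<eta> (\<xi>, \<omega>)) = Dv (\<xi>, \<omega>)"
  proof -
    obtain \<eta> where "\<eta> \<in> XX \<times> WW \<rightarrow> P" and
      *: "\<forall>x\<in>XX. \<forall>w\<in>WW.
          A (\<eta> (x, w)) = Av (x, w) \<and> B (\<eta> (x, w)) = Bv (x, w) \<and>
          C (\<eta> (x, w)) = Cv (x, w) \<and> D (\<eta> (x, w)) = Dv (x, w)"
      using emb(1) unfolding vpv_embedding_def by blast
    \<comment> \<open>Equal products need not have equal factors when one of them is empty, so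
      membership is transferred for both coordinates at once.\<close>
    moreover have "\<xi> \<in> XX \<and> \<omega> \<in> WW" if "\<xi> \<in> X" "\<omega> \<in> W" for \<xi> \<omega>
      using that emb(2) by blast
    ultimately show thesis
      using that[of \<eta>] emb(2) by auto
  qed
  have Cn: "Cn_curve 1 {0..} x'" "Cn_curve 0 {0..} w'" "Cn_curve 0 {0..} z'"
    and w_diff: "w differentiable_on {0..}"
    using sol by (simp_all add: solutions_def x'_def w'_def z'_def numeral_2_eq_2)
  have mem: "x ` {0..} \<subseteq> X" "w ` {0..} \<subseteq> W"
    and x_deriv: "\<And>t. t \<ge> 0 \<Longrightarrow> (x has_vector_derivative f (x t, w t)) (at t within {0..})"
    and z_eq: "\<And>t. t \<ge> 0 \<Longrightarrow> z t = h (x t, w t)"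
    using sol by (auto simp: solutions_def)
  have x'_eq: "x' t = f (x t, w t)" if "t \<ge> 0" for t
    unfolding x'_def using x_deriv[OF that] that by (rule vector_derivative_within_Ici)
  have w_deriv: "(w has_vector_derivative w' t) (at t within {0..})" if "t \<ge> 0" for t
    using w_diff that unfolding differentiable_on_def w'_def
    by (simp add: vector_derivative_works)
  \<comment> \<open>\<open>vpv_behaviour\<close> ranges over all functions from \<open>{0..}\<close>
    to \<open>P\<close>, so only the range of this scheduling signal has to be checked.\<close>
  define p where "p = (\<lambda>t. \<eta> (x t, w t))"
  have chain: "((\<lambda>t. g (x t, w t)) has_vector_derivative
      (Gx (x t, w t) *v x' t + Gw (x t, w t) *v w' t)) (at t within {0..})"
    if "t \<ge> 0" "C1_on (X \<times> W) g" "partial_jacobians X W g Gx Gw"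
    for t and g :: "_ \<Rightarrow> real^'m" and Gx Gw
    using partial_jacobians_chain_rule[OF that(2,3) _ mem(1) w_deriv mem(2)] x_deriv that x'_eq
    by simp
  have "(x' has_vector_derivative (A (p t) *v x' t + B (p t) *v w' t)) (at t within {0..}) \<and>
      z' t = C (p t) *v x' t + D (p t) *v w' t" if "t \<ge> 0" for t
  proof
    have p: "A (p t) = Av (x t, w t)" "B (p t) = Bv (x t, w t)"
      "C (p t) = Cv (x t, w t)" "D (p t) = Dv (x t, w t)"
      using \<eta>(2)[of "x t" "w t"] mem that by (auto simp: p_def)
    \<comment> \<open>On \<open>{0..}\<close> the velocity \<open>x'\<close> is \<open>f\<close>
      along the solution, so the chain rule for \<open>f\<close> yields the second derivative of
      \<open>x\<close>.\<close>
    show "(x' has_vector_derivative (A (p t) *v x' t + B (p t) *v w' t)) (at t within {0..})"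
      unfolding p
      by (rule has_vector_derivative_transform[OF _ _ chain[OF that f]]) (use that x'_eq in auto)
    \<comment> \<open>Here \<open>z\<close> itself, rather than \<open>z'\<close>, is
      \<open>h\<close> along the solution; differentiating once turns the output equation into an
      equation for \<open>z'\<close>.\<close>
    have "(z has_vector_derivative (Cv (x t, w t) *v x' t + Dv (x t, w t) *v w' t)) (at t within {0..})"
      by (rule has_vector_derivative_transform[OF _ _ chain[OF that h]]) (use that z_eq in auto)
    then show "z' t = C (p t) *v x' t + D (p t) *v w' t"
      unfolding p z'_def using that by (rule vector_derivative_within_Ici)
  qed
  then have "(x', w', z') \<in> lpv_behaviour A B C D p"
    using Cn by (simp add: lpv_behaviour_def)
  moreover have "p \<in> {0..} \<rightarrow> P"
    using \<eta>(1) mem by (auto simp: p_def)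
  ultimately show "traj \<in> vpv_behaviour P A B C D"
    unfolding traj vpv_behaviour_def x'_def w'_def z'_def by blast
qed

lemma dissipative_behaviour_mono:
  assumes "dissipative_behaviour s \<BB>" and "\<BB>' \<subseteq> \<BB>"
  shows "dissipative_behaviour s \<BB>'"
  using assms unfolding dissipative_behaviour_def by (meson subsetD)

theorem theorem7:
  fixes X XX :: "(real^'nx) set" and W WW :: "(real^'nw) set" and Z :: "(real^'nz) set"
    and f :: "(real^'nx) \<times> (real^'nw) \<Rightarrow> real^'nx"
    and h :: "(real^'nx) \<times> (real^'nw) \<Rightarrow> real^'nz"
    and Av :: "(real^'nx) \<times> (real^'nw) \<Rightarrow> real^'nx^'nx"
    and Bv :: "(real^'nx) \<times> (real^'nw) \<Rightarrow> real^'nw^'nx"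
    and Cv :: "(real^'nx) \<times> (real^'nw) \<Rightarrow> real^'nx^'nz"
    and Dv :: "(real^'nx) \<times> (real^'nw) \<Rightarrow> real^'nw^'nz"
    and F :: "((real^'np) \<Rightarrow> real) set" and P :: "(real^'np) set"
    and A :: "real^'np \<Rightarrow> real^'nx^'nx" and B :: "real^'np \<Rightarrow> real^'nw^'nx"
    and C :: "real^'np \<Rightarrow> real^'nx^'nz" and D :: "real^'np \<Rightarrow> real^'nw^'nz"
    and s :: "real^'nw \<Rightarrow> real^'nz \<Rightarrow> real"
  assumes "nonlinear_system X W Z f h"
    and "partial_jacobians X W f Av Bv"
    and "partial_jacobians X W h Cv Dv"
    and "vpv_embedding F X W Av Bv Cv Dv XX WW P A B C D"
    and "XX \<times> WW = X \<times> W"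
    and "classically_dissipative P A B C D s"
  shows "velocity_dissipative X W Z f h s"
proof -
  have "velocity_behaviour X W Z f h \<subseteq> vpv_behaviour P A B C D"
    using assms velocity_behaviour_subset_vpv_behaviour unfolding nonlinear_system_def by blast
  then show ?thesis
    using assms(6) dissipative_behaviour_mono
    unfolding classically_dissipative_def velocity_dissipative_def by blast
qed

end
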